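(* Every source-free break digraph on $n$ vertices has a quasi-kernel of size at most $2n/3$.
   Context: All digraphs are finite and loopless. An oriented graph is a digraph with no pair of opposite arcs; a tournament is an orientation of a complete graph; a digraph is acyclic if it has no directed cycle. An oriented graph $D$ is a break digraph if its vertex set can be partitioned as $V(D)=S\,\dot\cup\,T$ such that the induced subdigraph $D[S]$ is acyclic and the induced subdigraph $D[T]$ is a tournament. A vertex is a source if it has no in-neighbor; a digraph is source-free if it has no source. A set of vertices is independent if there is no arc between any two of its vertices. A quasi-kernel of a digraph $D$ is an independent set $Q\subseteq V(D)$ such that every vertex of $D$ is reachable from some vertex of $Q$ by a directed path of length at most $2$ (length $0$ allowed). *)

theory Defs
  imports Complex_Main "Graph_Theory.Graph_Theory"
begin

definition oriented_graph :: "('a, 'b) pre_digraph \<Rightarrow> bool" where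
  "oriented_graph D \<longleftrightarrow>
     digraph D \<and> (\<forall>u v. u \<rightarrow>\<^bsub>D\<^esub> v \<longrightarrow> \<not> v \<rightarrow>\<^bsub>D\<^esub> u)"

text \<open>An orientation of a complete graph: between any two distinct vertices there is an arc,
  and, the digraph being oriented, in one direction only.\<close>

definition tournament :: "('a, 'b) pre_digraph \<Rightarrow> bool" where
  "tournament D \<longleftrightarrow> oriented_graph D \<and>
     (\<forall>u \<in> verts D. \<forall>v \<in> verts D. u \<noteq> v \<longrightarrow> u \<rightarrow>\<^bsub>D\<^esub> v \<or> v \<rightarrow>\<^bsub>D\<^esub> u)"

definition acyclic_digraph :: "('a, 'b) pre_digraph \<Rightarrow> bool" where
  "acyclic_digraph D \<longleftrightarrow> (\<nexists>p. pre_digraph.cycle D p)"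

text \<open>The parts \<open>S\<close> and \<open>T\<close> may be empty.\<close>

definition break_digraph :: "('a, 'b) pre_digraph \<Rightarrow> bool" where
  "break_digraph D \<longleftrightarrow> oriented_graph D \<and>
     (\<exists>S T. S \<union> T = verts D \<and> S \<inter> T = {} \<and>
        acyclic_digraph (D \<restriction> S) \<and> tournament (D \<restriction> T))"

definition source :: "('a, 'b) pre_digraph \<Rightarrow> 'a \<Rightarrow> bool" where
  "source D v \<longleftrightarrow> v \<in> verts D \<and> (\<nexists>u. u \<rightarrow>\<^bsub>D\<^esub> v)"

definition source_free :: "('a, 'b) pre_digraph \<Rightarrow> bool" where
  "source_free D \<longleftrightarrow> (\<nexists>v. source D v)"

definition independent_set :: "('a, 'b) pre_digraph \<Rightarrow> 'a set \<Rightarrow> bool" where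
  "independent_set D Q \<longleftrightarrow> Q \<subseteq> verts D \<and> (\<forall>u \<in> Q. \<forall>v \<in> Q. \<not> u \<rightarrow>\<^bsub>D\<^esub> v)"

text \<open>A path is given by its list of arcs, so its length is the length of that list.\<close>

definition quasi_kernel :: "('a, 'b) pre_digraph \<Rightarrow> 'a set \<Rightarrow> bool" where
  "quasi_kernel D Q \<longleftrightarrow> independent_set D Q \<and>
     (\<forall>v \<in> verts D. \<exists>q \<in> Q. \<exists>p. pre_digraph.apath D q p v \<and> length p \<le> 2)"

end

theory Submission
  imports Defs
begin

text \<open>For all vertex weights there is a quasi-kernel \<open>Q\<close> whose closed out-neighbourhood carries at
  least half of the total weight. If an arc goes from \<open>u\<close> to \<open>t \<in> T\<close> and every in-neighbour of \<open>u\<close> is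
  one of \<open>t\<close>, delete \<open>t\<close> and move its weight to \<open>u\<close>. Otherwise consider for each vertex \<open>x\<close> the set
  \<open>I x\<close> consisting of \<open>x\<close> and a kernel of the vertices of \<open>S\<close> not adjacent to \<open>x\<close>; an averaging
  argument over these sets yields the heavy quasi-kernel.

  Now fix an in-neighbour \<open>f v\<close> of each vertex \<open>v\<close>, let \<open>M\<close> be the set of vertices outside the image of
  \<open>f\<close>, and give \<open>v\<close> the weight \<open>card {x \<in> M. f x = v}\<close>. Discarding superfluous vertices of \<open>Q\<close> in two
  different ways gives quasi-kernels with at most \<open>(n + m/2) / 2\<close> and at most \<open>n - m/2\<close> vertices, where
  \<open>m = card M\<close>; the smaller of the two has at most \<open>2n/3\<close> vertices.\<close>

section \<open>Quasi-kernels of relations\<close>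

text \<open>The closed out-neighbourhood. Relation and vertex set are kept apart so that deleting a
  vertex shrinks \<open>V\<close> and leaves \<open>r\<close> alone.\<close>

definition dominated_in :: "'a rel \<Rightarrow> 'a set \<Rightarrow> 'a set \<Rightarrow> 'a set" where
  "dominated_in r V Q = V \<inter> (Q \<union> r `` Q)"

definition rel_quasi_kernel :: "'a rel \<Rightarrow> 'a set \<Rightarrow> 'a set \<Rightarrow> bool" where
  "rel_quasi_kernel r V Q \<longleftrightarrow>
     Q \<subseteq> V \<and> r \<inter> Q \<times> Q = {} \<and> V \<subseteq> dominated_in r V (dominated_in r V Q)"

section \<open>Kernels and weighted averaging\<close>

text \<open>A vertex \<open>x\<close> without in-neighbours in \<open>X\<close> extends any kernel
  of what remains after removing \<open>x\<close> and its out-neighbours.\<close>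

lemma acyclic_kernel:
  assumes "finite X" "acyclic (r \<inter> X \<times> X)"
  shows "\<exists>K \<subseteq> X. r \<inter> K \<times> K = {} \<and> X \<subseteq> K \<union> r `` K"
  using assms
proof (induction X rule: finite_psubset_induct)
  case (psubset X)
  show ?case
  proof (cases "X = {}")
    case False
    have "wf (r \<inter> X \<times> X)"
      using psubset by (intro finite_acyclic_wf) auto
    moreover obtain x0 where "x0 \<in> X" using False by blast
    ultimately obtain x where x: "x \<in> X" "\<And>y. (y, x) \<in> r \<inter> X \<times> X \<Longrightarrow> y \<notin> X"
      by (rule wfE_min) blast
    define Y where "Y = X - insert x (r `` {x})"
    have "Y \<subset> X"
      using x(1) unfolding Y_def by blast
    moreover have "acyclic (r \<inter> Y \<times> Y)"
      unfolding Y_def by (rule acyclic_subset[OF psubset.prems]) blast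
    ultimately obtain K where K: "K \<subseteq> Y" "r \<inter> K \<times> K = {}" "Y \<subseteq> K \<union> r `` K"
      using psubset.IH by meson
    have "r \<inter> insert x K \<times> insert x K = {}"
      using K x unfolding Y_def by blast
    moreover have "X \<subseteq> insert x K \<union> r `` insert x K"
      using K(3) unfolding Y_def by blast
    moreover have "insert x K \<subseteq> X"
      using K(1) x(1) unfolding Y_def by blast
    ultimately show ?thesis by blast
  qed auto
qed

text \<open>Pick \<open>x\<close> with probability proportional to \<open>w x\<close>: each pair
  counts in at most one order, so the expected weight of the \<open>y\<close> with
  \<open>B x y\<close> is at most half.\<close>

lemma exists_light_in_antisymmetric:
  fixes w :: "'a \<Rightarrow> nat"
  assumes V: "finite V" "V \<noteq> {}"
    and asym: "\<And>x y. x \<in> V \<Longrightarrow> y \<in> V \<Longrightarrow> B x y \<Longrightarrow> \<not> B y x"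
  shows "\<exists>x \<in> V. 2 * (\<Sum>y | y \<in> V \<and> B x y. w y) \<le> sum w V"
proof (rule ccontr)
  define L where "L x = (\<Sum>y | y \<in> V \<and> B x y. w y)" for x
  assume "\<not> ?thesis"
  then have heavy: "sum w V < 2 * L x" if "x \<in> V" for x
    using that by (force simp: L_def)
  have L_alt: "L x = (\<Sum>y\<in>V. if B x y then w y else 0)" for x
    unfolding L_def using V(1) by (subst sum.inter_filter) auto
  let ?c = "\<lambda>x y. w x * (if B x y then w y else 0)"
  have swap: "(\<Sum>x\<in>V. \<Sum>y\<in>V. ?c x y) = (\<Sum>x\<in>V. \<Sum>y\<in>V. ?c y x)"
    by (rule sum.swap)
  \<comment> \<open>A vertex of positive weight makes the comparison of sums below strict.\<close>
  have "sum w V > 0"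
  proof (rule ccontr)
    assume "\<not> ?thesis"
    then have "L x = 0" for x
      unfolding L_def using V(1) by auto
    then show False using heavy V by fastforce
  qed
  then obtain z where z: "z \<in> V" "w z > 0"
    by (metis not_gr_zero sum.neutral)
  have "sum w V * sum w V = (\<Sum>x\<in>V. w x * sum w V)"
    by (simp add: sum_distrib_right)
  also have "\<dots> < (\<Sum>x\<in>V. w x * (2 * L x))"
  proof (rule sum_strict_mono_ex1)
    show "\<forall>x\<in>V. w x * sum w V \<le> w x * (2 * L x)"
      using heavy by (intro ballI mult_le_mono2 less_imp_le)
    show "\<exists>x\<in>V. w x * sum w V < w x * (2 * L x)"
      using heavy z by (intro bexI[of _ z]) simp_all
  qed fact
  also have "\<dots> = (\<Sum>x\<in>V. \<Sum>y\<in>V. ?c x y) + (\<Sum>x\<in>V. \<Sum>y\<in>V. ?c x y)"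
    by (simp add: L_alt sum_distrib_left mult.assoc mult.left_commute[of 2] flip: mult_2)
  \<comment> \<open>Renaming the variables in one copy pairs \<open>B x y\<close> with
    \<open>B y x\<close>, of which at most one holds.\<close>
  also have "\<dots> = (\<Sum>x\<in>V. \<Sum>y\<in>V. ?c x y + ?c y x)"
    by (subst (2) swap) (simp add: sum.distrib)
  also have "\<dots> \<le> (\<Sum>x\<in>V. \<Sum>y\<in>V. w x * w y)"
    by (intro sum_mono) (use asym in auto)
  also have "\<dots> = sum w V * sum w V"
    by (simp add: sum_product)
  finally show False by simp
qed

section \<open>Heavy quasi-kernels\<close>

text \<open>\<open>undom\<close> makes \<open>I t\<close> a quasi-kernel for \<open>t\<close> in
  \<open>T\<close>; a vertex \<open>s\<close> of \<open>S\<close> gets a substitute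
  \<open>\<sigma> s\<close>. Misses between the assigned sets are asymmetric, so averaging finds a
  heavy one. If it is no quasi-kernel, some \<open>I u\<close> with \<open>u\<close> in
  \<open>T\<close> dominates at least as much.\<close>

lemma heavy_quasi_kernel_undominated:
  fixes w :: "'a \<Rightarrow> nat"
  assumes fin: "finite S" "finite T" and disj: "S \<inter> T = {}" and ne: "S \<union> T \<noteq> {}"
    and irr: "\<And>x. (x, x) \<notin> r"
    and acyc: "acyclic (r \<inter> S \<times> S)"
    and tour: "\<And>t u. t \<in> T \<Longrightarrow> u \<in> T \<Longrightarrow> t \<noteq> u \<Longrightarrow> (t, u) \<in> r \<or> (u, t) \<in> r"
    and undom: "\<And>u t. t \<in> T \<Longrightarrow> u \<in> S \<union> T \<Longrightarrow> (u, t) \<in> r \<Longrightarrow>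
                  \<exists>z \<in> S \<union> T. (z, u) \<in> r \<and> (z, t) \<notin> r"
  shows "\<exists>Q. rel_quasi_kernel r (S \<union> T) Q \<and>
           2 * sum w (S \<union> T - dominated_in r (S \<union> T) Q) \<le> sum w (S \<union> T)"
proof -
  define V where "V = S \<union> T"
  \<comment> \<open>The implication lets choice produce a total \<open>k\<close>, arbitrary outside
    the subsets of \<open>S\<close>.\<close>
  have "\<forall>X. \<exists>K. X \<subseteq> S \<longrightarrow> K \<subseteq> X \<and> r \<inter> K \<times> K = {} \<and> X \<subseteq> K \<union> r `` K"
  proof (intro allI)
    fix X
    show "\<exists>K. X \<subseteq> S \<longrightarrow> K \<subseteq> X \<and> r \<inter> K \<times> K = {} \<and> X \<subseteq> K \<union> r `` K"
    proof (cases "X \<subseteq> S")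
      case True
      then have "finite X"
        using fin(1) by (rule finite_subset)
      moreover have "acyclic (r \<inter> X \<times> X)"
        using True by (intro acyclic_subset[OF acyc]) blast
      ultimately show ?thesis
        using acyclic_kernel[of X r] by blast
    qed auto
  qed
  then obtain k where k: "\<And>X. X \<subseteq> S \<Longrightarrow> k X \<subseteq> X \<and> r \<inter> k X \<times> k X = {} \<and> X \<subseteq> k X \<union> r `` k X"
    by metis
  define J where "J x = S - insert x (r `` {x} \<union> r\<inverse> `` {x})" for x
  define I where "I x = insert x (k (J x))" for x
  define H where "H x = dominated_in r V (I x)" for x
  have kI: "k (J x) \<subseteq> J x" "r \<inter> k (J x) \<times> k (J x) = {}" "J x \<subseteq> k (J x) \<union> r `` k (J x)" for x
    using k[of "J x"] by (auto simp: J_def)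
  have I_sub: "I x \<subseteq> V" if "x \<in> V" for x
    using kI(1)[of x] that unfolding I_def J_def V_def by blast
  have I_ind: "r \<inter> I x \<times> I x = {}" for x
    using kI(1,2)[of x] irr unfolding I_def J_def by blast
  have H_sub: "H x \<subseteq> V" for x
    by (auto simp: H_def dominated_in_def)
  have H_self: "x \<in> H x" if "x \<in> V" for x
    using that by (auto simp: H_def dominated_in_def I_def)
  have H_out: "y \<in> H x" if "y \<in> V" "(x, y) \<in> r" for x y
    using that by (auto simp: H_def dominated_in_def I_def)
  \<comment> \<open>A missed vertex of \<open>S\<close> is not \<open>x\<close>, not an
    out-neighbour of \<open>x\<close>, and not in \<open>J x\<close>, which its kernel
    dominates.\<close>
  have H_S: "(y, x) \<in> r" if "x \<in> V" "y \<in> S" "y \<notin> H x" for x y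
    using kI(3)[of x] that unfolding H_def dominated_in_def I_def J_def V_def by blast
  have H_T: "(y, x) \<in> r" if "x \<in> T" "y \<in> V" "y \<notin> H x" for x y
    using H_S[of x y] H_out[of y x] H_self[of x] tour[of x y] that unfolding V_def by blast
  \<comment> \<open>An unreached \<open>u\<close> has an arc to \<open>x\<close>. The in-neighbour
    \<open>z\<close> of \<open>u\<close> from \<open>undom\<close> has none, so it lies in
    \<open>H x\<close> and reaches \<open>u\<close>.\<close>
  have reach_T: "rel_quasi_kernel r V (I x)" if x: "x \<in> T" for x
  proof -
    have "u \<in> dominated_in r V (H x)" if u: "u \<in> V" for u
    proof (rule ccontr)
      assume n: "u \<notin> dominated_in r V (H x)"
      then have "u \<notin> H x" using u by (auto simp: dominated_in_def)
      then have "(u, x) \<in> r" using H_T x u by blast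
      then obtain z where z: "z \<in> V" "(z, u) \<in> r" "(z, x) \<notin> r"
        using undom x u unfolding V_def by blast
      then have "z \<in> H x" using H_T x by blast
      then show False using n u z by (auto simp: dominated_in_def)
    qed
    then show ?thesis
      using x I_sub I_ind unfolding rel_quasi_kernel_def H_def V_def by blast
  qed
  text \<open>An unreached \<open>u \<in> S\<close> has an arc to \<open>s\<close>, and \<open>I u\<close> still dominates every \<open>t \<in> T\<close> whose \<open>I t\<close>
    misses \<open>s\<close>. So \<open>s\<close> may be replaced by \<open>u\<close>, which terminates since \<open>S\<close> is acyclic.\<close>
  have "\<exists>s'. s' \<in> S \<and> (s', s) \<in> (r \<inter> S \<times> S)\<^sup>* \<and> (\<forall>t\<in>T. s \<notin> H t \<longrightarrow> s' \<notin> H t)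
      \<and> S \<subseteq> dominated_in r V (H s')" if "s \<in> S" for s
  proof -
    have "wf (r \<inter> S \<times> S)"
      using fin acyc by (intro finite_acyclic_wf) auto
    then show ?thesis using that
    proof (induction s rule: wf_induct_rule)
      case (less s)
      show ?case
      proof (cases "S \<subseteq> dominated_in r V (H s)")
        case True
        then show ?thesis using less.prems by blast
      next
        case False
        then obtain u where u: "u \<in> S" "u \<notin> dominated_in r V (H s)" by blast
        have sV: "s \<in> V" and uV: "u \<in> V" using less.prems u by (auto simp: V_def)
        have uH: "u \<notin> H s" and nopre: "\<And>z. z \<in> H s \<Longrightarrow> (z, u) \<notin> r"
          using u uV by (auto simp: dominated_in_def)
        have us: "(u, s) \<in> r" using H_S sV u uH by blast
        \<comment> \<open>Neither \<open>u\<close> nor any other in-neighbour of \<open>s\<close> is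
          in \<open>I t\<close>. A \<open>q\<close> in \<open>I t\<close> with an arc to
          \<open>u\<close> is not \<open>t\<close>, which lies in \<open>H s\<close>; so
          \<open>q\<close> is in \<open>S\<close>, is missed by \<open>I s\<close>, and has an arc
          to \<open>s\<close>.\<close>
        have Tu: "u \<notin> H t" if t: "t \<in> T" "s \<notin> H t" for t
        proof
          assume "u \<in> H t"
          then have cases: "u \<in> I t \<or> (\<exists>q \<in> I t. (q, u) \<in> r)"
            by (auto simp: H_def dominated_in_def)
          have out: "q \<notin> I t" if "(q, s) \<in> r" for q
            using that t(2) sV by (auto simp: H_def dominated_in_def)
          have tV: "t \<in> V" using t by (auto simp: V_def)
          have tH: "t \<in> H s" using H_T t sV H_out tV by blast
          obtain q where q: "q \<in> I t" "(q, u) \<in> r"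
            using cases out us by blast
          have "q \<noteq> t" using nopre tH q by blast
          then have "q \<in> S" using q kI(1)[of t] unfolding I_def J_def by blast
          then show False using H_S[OF sV] nopre q out by blast
        qed
        have "(u, s) \<in> r \<inter> S \<times> S" using us u less.prems by blast
        from less.IH[OF this u(1)] obtain s' where "s' \<in> S" "(s', u) \<in> (r \<inter> S \<times> S)\<^sup>*"
          "\<forall>t\<in>T. u \<notin> H t \<longrightarrow> s' \<notin> H t" "S \<subseteq> dominated_in r V (H s')" by blast
        then show ?thesis
          using \<open>(u, s) \<in> r \<inter> S \<times> S\<close> Tu by (meson rtrancl.rtrancl_into_rtrancl)
      qed
    qed
  qed
  then obtain \<sigma> where \<sigma>: "\<And>s. s \<in> S \<Longrightarrow> \<sigma> s \<in> S"
    "\<And>s. s \<in> S \<Longrightarrow> (\<sigma> s, s) \<in> (r \<inter> S \<times> S)\<^sup>*"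
    "\<And>s t. s \<in> S \<Longrightarrow> t \<in> T \<Longrightarrow> s \<notin> H t \<Longrightarrow> \<sigma> s \<notin> H t"
    "\<And>s. s \<in> S \<Longrightarrow> S \<subseteq> dominated_in r V (H (\<sigma> s))"
    by metis
  define B where "B x y \<longleftrightarrow> y \<notin> H (if x \<in> T then x else \<sigma> x)" for x y
  \<comment> \<open>By its choice \<open>\<sigma> s\<close> is missed by \<open>I t\<close> too, so
    it has an arc to \<open>t\<close>.\<close>
  have ST: "\<not> B s t" if "s \<in> S" "t \<in> T" "B t s" for s t
  proof -
    have "\<sigma> s \<notin> H t" using \<sigma>(3) that by (auto simp: B_def)
    then have "(\<sigma> s, t) \<in> r" using H_T \<sigma>(1) that by (auto simp: V_def)
    then show ?thesis using H_out[of t "\<sigma> s"] that disj by (auto simp: B_def V_def)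
  qed
  \<comment> \<open>A miss \<open>B p q\<close> gives a path in \<open>S\<close> from
    \<open>q\<close> through \<open>\<sigma> p\<close> to \<open>p\<close>; opposite misses would
    close a cycle.\<close>
  have SS: "\<not> B y x" if "x \<in> S" "y \<in> S" "B x y" for x y
  proof
    assume "B y x"
    have *: "(q, p) \<in> (r \<inter> S \<times> S)\<^sup>+" if "p \<in> S" "q \<in> S" "B p q" for p q
    proof -
      have "p \<notin> T" using that disj by blast
      then have "(q, \<sigma> p) \<in> r \<inter> S \<times> S"
        using that H_S[of "\<sigma> p" q] \<sigma>(1)[of p] by (simp add: B_def V_def)
      then show ?thesis using \<sigma>(2)[OF that(1)] by (rule rtrancl_into_trancl2)
    qed
    have "(x, x) \<in> (r \<inter> S \<times> S)\<^sup>+"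
      using *[OF that(2,1) \<open>B y x\<close>] *[OF that] by (rule trancl_trans)
    then show False using acyc by (auto simp: acyclic_def)
  qed
  have TT: "\<not> B y x" if "x \<in> T" "y \<in> T" "B x y" for x y
  proof -
    have "(y, x) \<in> r" using that H_T by (auto simp: B_def V_def)
    then show ?thesis using that H_out by (auto simp: B_def V_def)
  qed
  have "\<exists>x\<in>V. 2 * (\<Sum>y | y \<in> V \<and> B x y. w y) \<le> sum w V"
  proof (rule exists_light_in_antisymmetric)
    fix x y assume "x \<in> V" "y \<in> V" "B x y"
    then show "\<not> B y x" using ST SS TT unfolding V_def by blast
  qed (use fin ne in \<open>auto simp: V_def\<close>)
  then obtain x where x: "x \<in> V" "2 * (\<Sum>y | y \<in> V \<and> B x y. w y) \<le> sum w V" by blast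
  define z where "z = (if x \<in> T then x else \<sigma> x)"
  have "{y. y \<in> V \<and> B x y} = V - H z"
    by (auto simp: B_def z_def)
  then have light: "2 * sum w (V - H z) \<le> sum w V"
    using x(2) by simp
  have zV: "z \<in> V" using x \<sigma>(1) by (auto simp: z_def V_def)
  have "\<exists>Q. rel_quasi_kernel r V Q \<and> 2 * sum w (V - dominated_in r V Q) \<le> sum w V"
  proof (cases "V \<subseteq> dominated_in r V (H z)")
    case True
    then show ?thesis
      using light I_sub[OF zV] I_ind unfolding rel_quasi_kernel_def H_def by blast
  next
    case False
    have "z \<notin> T"
      using False reach_T[of z] by (auto simp: rel_quasi_kernel_def H_def)
    then have "S \<subseteq> dominated_in r V (H z)"
      using x(1) \<sigma>(4) by (auto simp: z_def V_def split: if_splits)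
    then obtain u where u: "u \<in> T" "u \<notin> dominated_in r V (H z)"
      using False by (auto simp: V_def)
    \<comment> \<open>Everything missed by \<open>I u\<close> has an arc to \<open>u\<close>, and no
      vertex of \<open>H z\<close> has one.\<close>
    then have "V - H u \<subseteq> V - H z"
      using H_T unfolding dominated_in_def V_def by blast
    then have "sum w (V - H u) \<le> sum w (V - H z)"
      using fin by (intro sum_mono2) (auto simp: V_def)
    then show ?thesis
      using light reach_T[OF u(1)] unfolding H_def by fastforce
  qed
  then show ?thesis by (simp add: V_def)
qed

text \<open>In the deletion case, every set dominating \<open>u\<close> dominates \<open>t\<close>.
  So a quasi-kernel found without \<open>t\<close> also serves with \<open>t\<close>, and moving the
  weight never underestimates the loss.\<close>

lemma heavy_quasi_kernel:
  fixes w :: "'a \<Rightarrow> nat"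
  assumes fin: "finite S" "finite T" and disj: "S \<inter> T = {}"
    and irr: "\<And>x. (x, x) \<notin> r"
    and acyc: "acyclic (r \<inter> S \<times> S)"
    and tour: "\<And>t u. t \<in> T \<Longrightarrow> u \<in> T \<Longrightarrow> t \<noteq> u \<Longrightarrow> (t, u) \<in> r \<or> (u, t) \<in> r"
  shows "\<exists>Q. rel_quasi_kernel r (S \<union> T) Q \<and>
           2 * sum w (S \<union> T - dominated_in r (S \<union> T) Q) \<le> sum w (S \<union> T)"
  using fin(2) disj tour
proof (induction T arbitrary: w rule: finite_psubset_induct)
  case (psubset T w)
  define V where "V = S \<union> T"
  consider "V = {}" | (undom) "V \<noteq> {}" "\<forall>t\<in>T. \<forall>u\<in>V. (u, t) \<in> r \<longrightarrow> (\<exists>z\<in>V. (z, u) \<in> r \<and> (z, t) \<notin> r)"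
    | (dom) t u where "t \<in> T" "u \<in> V" "(u, t) \<in> r" "\<forall>z\<in>V. (z, u) \<in> r \<longrightarrow> (z, t) \<in> r"
    by blast
  then show ?case
  proof cases
    case 1
    then show ?thesis
      by (intro exI[of _ "{}"]) (auto simp: rel_quasi_kernel_def dominated_in_def V_def)
  next
    case undom
    then show ?thesis
      using heavy_quasi_kernel_undominated[of S T r w] fin(1) psubset.hyps psubset.prems irr acyc
      unfolding V_def by blast
  next
    case dom
    define w' where "w' = w(u := w u + w t)"
    define W where "W = S \<union> (T - {t})"
    have W: "W = V - {t}" "V = insert t W" "t \<notin> W" "finite W" "u \<in> W"
      using dom psubset.prems(1) psubset.hyps fin irr by (auto simp: W_def V_def)
    have "\<exists>Q. rel_quasi_kernel r W Q \<and> 2 * sum w' (W - dominated_in r W Q) \<le> sum w' W"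
      unfolding W_def by (rule psubset.IH) (use dom psubset.prems in auto)
    then obtain Q where Q: "rel_quasi_kernel r W Q"
      "2 * sum w' (W - dominated_in r W Q) \<le> sum w' W" by blast
    have QW: "Q \<subseteq> W" and ind: "r \<inter> Q \<times> Q = {}"
      and reach: "W \<subseteq> dominated_in r W (dominated_in r W Q)"
      using Q(1) by (auto simp: rel_quasi_kernel_def)
    have domH: "t \<in> dominated_in r V X" if "u \<in> dominated_in r W X" "X \<subseteq> W" for X
      using that dom W unfolding dominated_in_def by blast
    have mono: "dominated_in r W X \<subseteq> dominated_in r V Y" if "X \<subseteq> Y" for X Y
      using that W unfolding dominated_in_def by blast
    have "t \<in> dominated_in r V (dominated_in r V Q)"
    proof -
      have "t \<in> dominated_in r V (dominated_in r W Q)"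
        using domH[of "dominated_in r W Q"] reach W(5) by (auto simp: dominated_in_def)
      moreover have "dominated_in r W Q \<subseteq> dominated_in r V Q"
        by (rule mono) simp
      ultimately show ?thesis
        unfolding dominated_in_def[of r V "dominated_in r _ Q"] by blast
    qed
    then have "V \<subseteq> dominated_in r V (dominated_in r V Q)"
      using reach mono[OF mono[OF subset_refl[of Q]]] W(2) by blast
    then have "rel_quasi_kernel r V Q"
      using QW ind W(2) by (auto simp: rel_quasi_kernel_def)
    moreover have total: "sum w' W = sum w V"
    proof -
      have "sum w' W = sum w' (W - {u}) + w' u"
        using W by (simp add: sum.remove)
      also have "\<dots> = sum w (W - {u}) + w u + w t"
        by (simp add: w'_def)
      also have "\<dots> = sum w V"
        using W by (simp add: sum.remove)
      finally show ?thesis .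
    qed
    moreover have "sum w (V - dominated_in r V Q) \<le> sum w' (W - dominated_in r W Q)"
    proof (cases "u \<in> dominated_in r W Q")
      case True
      then have "V - dominated_in r V Q \<subseteq> W - dominated_in r W Q"
        using domH[OF True QW] mono[OF subset_refl[of Q]] W(2) by blast
      then have "sum w (V - dominated_in r V Q) \<le> sum w (W - dominated_in r W Q)"
        using W(4) by (intro sum_mono2) auto
      also have "\<dots> \<le> sum w' (W - dominated_in r W Q)"
        by (intro sum_mono) (auto simp: w'_def)
      finally show ?thesis .
    next
      case False
      \<comment> \<open>As \<open>u\<close> is undominated, \<open>w' u\<close> pays for both
        \<open>u\<close> and \<open>t\<close>, whether or not \<open>t\<close> is dominated.\<close>
      let ?R = "W - dominated_in r W Q"
      have "sum w (V - dominated_in r V Q) \<le> sum w (insert t ?R)"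
        using W(2,4) mono[OF subset_refl[of Q]] by (intro sum_mono2) auto
      also have "\<dots> = w t + (w u + sum w (?R - {u}))"
        using W False by (simp add: sum.remove)
      also have "\<dots> = w' u + sum w' (?R - {u})"
        by (simp add: w'_def)
      also have "\<dots> = sum w' ?R"
        using W False by (simp add: sum.remove)
      finally show ?thesis .
    qed
    ultimately show ?thesis
      using Q(2) unfolding V_def by fastforce
  qed
qed

section \<open>From heavy to small quasi-kernels\<close>

text \<open>Subsets of \<open>Q\<close> stay independent, so pruning only has to preserve
  reachability. The troublesome vertices are those in \<open>P\<close>, and the weights are chosen
  so that they make up at most half of \<open>M\<close>.\<close>

lemma small_quasi_kernel_if_heavy:
  assumes fin: "finite V"
    and f: "\<And>v. v \<in> V \<Longrightarrow> f v \<in> V" "\<And>v. v \<in> V \<Longrightarrow> (f v, v) \<in> r"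
    and heavy: "\<And>w :: 'a \<Rightarrow> nat. \<exists>Q. rel_quasi_kernel r V Q \<and>
                   2 * sum w (V - dominated_in r V Q) \<le> sum w V"
  shows "\<exists>Q. rel_quasi_kernel r V Q \<and> 3 * card Q \<le> 2 * card V"
proof -
  define M where "M = V - f ` V"
  define w where "w v = card {x \<in> M. f x = v}" for v
  obtain Q where Q: "rel_quasi_kernel r V Q" "2 * sum w (V - dominated_in r V Q) \<le> sum w V"
    using heavy by blast
  define R where "R = V - dominated_in r V Q"
  define N where "N = dominated_in r V Q - Q"
  define P where "P = {x \<in> M. f x \<in> R}"
  have finM: "finite M" "finite P" using fin by (auto simp: M_def P_def)
  have QV: "Q \<subseteq> V" and ind: "r \<inter> Q \<times> Q = {}"
    using Q(1) by (auto simp: rel_quasi_kernel_def)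
  have V_split: "V = Q \<union> N \<union> R" "Q \<inter> N = {}" "Q \<inter> R = {}" "N \<inter> R = {}"
    using QV by (auto simp: N_def R_def dominated_in_def)
  have finQ: "finite Q" "finite N" using V_split(1) fin by (auto intro: finite_subset)
  have w_sum: "sum w X = card {x \<in> M. f x \<in> X}" if "X \<subseteq> V" for X
  proof -
    have "finite X" using that fin finite_subset by blast
    then have "sum w X = card (\<Union>v\<in>X. {x \<in> M. f x = v})"
      unfolding w_def using finM by (subst card_UN_disjoint) auto
    also have "(\<Union>v\<in>X. {x \<in> M. f x = v}) = {x \<in> M. f x \<in> X}" by auto
    finally show ?thesis .
  qed
  have "sum w V = card M"
  proof -
    have "{x \<in> M. f x \<in> V} = M" using f(1) by (auto simp: M_def)
    then show ?thesis using w_sum[of V] by simp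
  qed
  moreover have "sum w R = card P"
    using w_sum[of R] by (simp add: R_def P_def)
  ultimately have P_le: "2 * card P \<le> card M"
    using Q(2) by (simp add: R_def)
  have M_card: "card M + card (f ` V) = card V"
  proof -
    have "f ` V \<subseteq> V" using f(1) by auto
    then show ?thesis
      using fin unfolding M_def by (simp add: card_Diff_subset card_mono finite_subset)
  qed
  have subset_qk: "rel_quasi_kernel r V Q'"
    if "Q' \<subseteq> Q" "\<And>v. v \<in> V \<Longrightarrow> v \<in> dominated_in r V (dominated_in r V Q')" for Q'
    using that QV ind unfolding rel_quasi_kernel_def by blast
  \<comment> \<open>\<open>h v\<close> is a vertex of \<open>Q\<close> responsible for
    \<open>v\<close>, at the smallest possible distance.\<close>
  have "\<exists>h. \<forall>v\<in>V. h v \<in> Q \<and> v \<in> dominated_in r V (dominated_in r V {h v}) \<and>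
          (v \<in> Q \<longrightarrow> h v = v) \<and> (v \<in> N \<longrightarrow> (h v, v) \<in> r)"
  proof (intro bchoice ballI)
    fix v assume v: "v \<in> V"
    consider "v \<in> Q" | "v \<in> N" | "v \<in> R" using v V_split(1) by blast
    then show "\<exists>q. q \<in> Q \<and> v \<in> dominated_in r V (dominated_in r V {q}) \<and>
          (v \<in> Q \<longrightarrow> q = v) \<and> (v \<in> N \<longrightarrow> (q, v) \<in> r)"
    proof cases
      case 1
      then show ?thesis using v V_split(2) by (auto simp: dominated_in_def)
    next
      case 2
      then obtain q where "q \<in> Q" "(q, v) \<in> r" by (auto simp: N_def dominated_in_def)
      then show ?thesis using v 2 V_split(2) QV by (auto simp: dominated_in_def)
    next
      case 3
      have "v \<in> dominated_in r V (dominated_in r V Q)"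
        using Q(1) v by (auto simp: rel_quasi_kernel_def)
      then obtain z where z: "z \<in> dominated_in r V Q" "z = v \<or> (z, v) \<in> r"
        by (auto simp: dominated_in_def)
      then obtain q where "q \<in> Q" "z \<in> dominated_in r V {q}"
        by (auto simp: dominated_in_def)
      then show ?thesis using z v 3 V_split(3,4) by (auto simp: dominated_in_def)
    qed
  qed
  then obtain h where h: "\<And>v. v \<in> V \<Longrightarrow> h v \<in> Q"
    "\<And>v. v \<in> V \<Longrightarrow> v \<in> dominated_in r V (dominated_in r V {h v})"
    "\<And>v. v \<in> Q \<Longrightarrow> h v = v" "\<And>v. v \<in> N \<Longrightarrow> (h v, v) \<in> r"
    using V_split(1) by blast
  have h_reach: "v \<in> dominated_in r V (dominated_in r V Q')" if "v \<in> V" "h v \<in> Q'" for v Q'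
    using h(2)[OF that(1)] that(2) by (auto simp: dominated_in_def)
  \<comment> \<open>Preferring \<open>f v\<close> ensures that every vertex of \<open>Q\<close> in
    the image of \<open>f\<close> is also a value of \<open>g\<close> on \<open>N\<close>.\<close>
  define g where "g v = (if f v \<in> Q then f v else h v)" for v
  \<comment> \<open>Dominating \<open>N\<close> suffices to reach \<open>R\<close> and each
    \<open>v\<close> in \<open>Q\<close> with \<open>f v\<close> in \<open>N\<close>. Any other
    \<open>v\<close> in \<open>Q\<close> is kept: it is a value of \<open>g\<close> or lies in
    \<open>P\<close>.\<close>
  define Q1 where "Q1 = g ` N \<union> (P \<inter> Q)"
  have NV: "N \<subseteq> V" using V_split(1) by blast
  have g: "g v \<in> Q" "(g v, v) \<in> r" if "v \<in> N" for v
    using that NV h(1,4) f(2) by (auto simp: g_def)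
  have Q1_sub: "Q1 \<subseteq> Q" using g(1) by (auto simp: Q1_def)
  have N_Q1: "v \<in> dominated_in r V Q1" if "v \<in> N" for v
    using that NV g(2)[OF that] unfolding Q1_def dominated_in_def by blast
  have "rel_quasi_kernel r V Q1"
  proof (rule subset_qk[OF Q1_sub])
    fix v assume v: "v \<in> V"
    consider "v \<in> Q" | "v \<in> N" | "v \<in> R" using v V_split(1) by blast
    then show "v \<in> dominated_in r V (dominated_in r V Q1)"
    proof cases
      case 1
      have "f v \<notin> Q" using f(2)[OF v] ind 1 by blast
      then consider "f v \<in> N" | "f v \<in> R" using f(1)[OF v] V_split(1) by blast
      then show ?thesis
      proof cases
        case 1
        then show ?thesis using N_Q1 f(2)[OF v] v by (auto simp: dominated_in_def)
      next
        case 2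
        have "v \<in> Q1"
        proof (cases "v \<in> f ` V")
          case True
          then obtain x where x: "x \<in> V" "v = f x" by blast
          then have "x \<in> N"
            using \<open>v \<in> Q\<close> f(2)[OF x(1)] ind QV unfolding N_def dominated_in_def by blast
          then show ?thesis using x \<open>v \<in> Q\<close> by (force simp: Q1_def g_def)
        next
          case False
          then show ?thesis using \<open>v \<in> Q\<close> 2 v by (auto simp: Q1_def P_def M_def)
        qed
        then show ?thesis using v by (auto simp: dominated_in_def)
      qed
    next
      case 2
      then show ?thesis using N_Q1 v by (auto simp: dominated_in_def)
    next
      case 3
      have "v \<in> dominated_in r V (dominated_in r V Q)"
        using Q(1) v by (auto simp: rel_quasi_kernel_def)
      then obtain z where z: "z \<in> dominated_in r V Q" "(z, v) \<in> r"
        using 3 by (auto simp: dominated_in_def R_def)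
      have "z \<in> N"
        using z 3 v by (auto simp: N_def R_def dominated_in_def)
      then show ?thesis using N_Q1 z(2) v by (auto simp: dominated_in_def)
    qed
  qed
  \<comment> \<open>Average of the bounds \<open>card N + card P\<close> and \<open>card Q\<close>,
    with \<open>Q\<close> and \<open>N\<close> disjoint.\<close>
  moreover have "2 * card Q1 \<le> card V + card P"
  proof -
    have "card Q1 \<le> card (g ` N) + card (P \<inter> Q)"
      unfolding Q1_def by (rule card_Un_le)
    also have "\<dots> \<le> card N + card P"
      using finM finQ by (intro add_mono card_image_le card_mono) auto
    finally have "card Q1 \<le> card N + card P" .
    moreover have "card Q1 \<le> card Q"
      using Q1_sub finQ by (intro card_mono)
    moreover have "card Q + card N \<le> card V"
    proof -
      have "card Q + card N = card (Q \<union> N)"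
        using finQ V_split(2) by (simp add: card_Un_disjoint)
      also have "\<dots> \<le> card V" using fin V_split(1) by (intro card_mono) auto
      finally show ?thesis .
    qed
    ultimately show ?thesis by linarith
  qed
  moreover
  \<comment> \<open>Each \<open>v\<close> is reached through \<open>f v\<close> unless
    \<open>f v\<close> is in \<open>R\<close>; then \<open>v\<close> is in the image of
    \<open>f\<close> or in \<open>P\<close>, and \<open>h v\<close> is kept.\<close>
  define Q2 where "Q2 = h ` (f ` V \<union> P)"
  have "rel_quasi_kernel r V Q2"
  proof (rule subset_qk)
    show "Q2 \<subseteq> Q" using h(1) f(1) by (auto simp: Q2_def P_def M_def)
    fix v assume v: "v \<in> V"
    have hf: "h (f v) \<in> Q2" using v by (auto simp: Q2_def)
    consider "f v \<in> Q" | "f v \<in> N" | "f v \<in> R" using f(1)[OF v] V_split(1) by blast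
    then show "v \<in> dominated_in r V (dominated_in r V Q2)"
    proof cases
      case 1
      then have "f v \<in> Q2" using hf h(3) by auto
      then show ?thesis using f[OF v] v by (auto simp: dominated_in_def)
    next
      case 2
      then have "f v \<in> dominated_in r V Q2"
        using hf h(4) f(1)[OF v] by (auto simp: dominated_in_def)
      then show ?thesis using f[OF v] v by (auto simp: dominated_in_def)
    next
      case 3
      then have "h v \<in> Q2" using v by (auto simp: Q2_def P_def M_def)
      then show ?thesis using h_reach v by blast
    qed
  qed
  moreover have "card Q2 \<le> card (f ` V) + card P"
  proof -
    have "card Q2 \<le> card (f ` V \<union> P)"
      unfolding Q2_def using fin finM by (intro card_image_le) auto
    also have "\<dots> \<le> card (f ` V) + card P" by (rule card_Un_le)
    finally show ?thesis .
  qed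
  \<comment> \<open>The first bound suffices if \<open>3 * card M \<le> 2 * card V\<close>, the
    second otherwise.\<close>
  moreover have "3 * card Q1 \<le> 2 * card V \<or> 3 * card Q2 \<le> 2 * card V"
    if "2 * card Q1 \<le> card V + card P" "card Q2 \<le> card (f ` V) + card P"
    using that P_le M_card by linarith
  ultimately show ?thesis by blast
qed

section \<open>Transfer to digraphs\<close>

text \<open>An \<open>apath\<close> has distinct vertices, so degenerate walks are shortened
  first.\<close>

lemma quasi_kernel_if_rel_quasi_kernel:
  assumes "wf_digraph D" "rel_quasi_kernel (arcs_ends D) (verts D) Q"
  shows "quasi_kernel D Q"
proof -
  interpret wf_digraph D by fact
  have QV: "Q \<subseteq> verts D" and ind: "arcs_ends D \<inter> Q \<times> Q = {}"
    and reach: "verts D \<subseteq> dominated_in (arcs_ends D) (verts D) (dominated_in (arcs_ends D) (verts D) Q)"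
    using assms(2) by (auto simp: rel_quasi_kernel_def)
  have "\<exists>q\<in>Q. \<exists>p. apath q p v \<and> length p \<le> 2" if v: "v \<in> verts D" for v
  proof -
    have nil: "apath v [] v" using v by (simp add: apath_Nil_iff)
    obtain z where z: "z \<in> verts D" "z \<in> Q \<or> (\<exists>q\<in>Q. q \<rightarrow>\<^bsub>D\<^esub> z)" "z = v \<or> z \<rightarrow>\<^bsub>D\<^esub> v"
      using reach v unfolding dominated_in_def by blast
    have one: ?thesis if q: "q \<in> Q" "q \<rightarrow>\<^bsub>D\<^esub> v" for q
    proof (cases "q = v")
      case False
      obtain e where e: "e \<in> arcs D" "tail D e = q" "head D e = v"
        using q(2) by (auto simp: arcs_ends_conv)
      then have "apath q [e] v"
        using False v by (auto simp: apath_def awalk_def)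
      then show ?thesis using q(1) by fastforce
    qed (use nil q in fastforce)
    \<comment> \<open>With \<open>v\<close> and \<open>z\<close> outside \<open>Q\<close> and
      \<open>z \<noteq> v\<close>, the three vertices of the two-arc walk are distinct.\<close>
    consider "v \<in> Q" | "\<exists>q\<in>Q. q \<rightarrow>\<^bsub>D\<^esub> v" |
      (two) q where "v \<notin> Q" "q \<in> Q" "z \<notin> Q" "q \<rightarrow>\<^bsub>D\<^esub> z" "z \<rightarrow>\<^bsub>D\<^esub> v" "z \<noteq> v"
      using z by blast
    then show ?thesis
    proof cases
      case two
      obtain e where e: "e \<in> arcs D" "tail D e = q" "head D e = z"
        using two by (auto simp: arcs_ends_conv)
      obtain e' where e': "e' \<in> arcs D" "tail D e' = z" "head D e' = v"
        using two by (auto simp: arcs_ends_conv)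
      have "apath q [e, e'] v"
        using e e' two by (auto simp: apath_def awalk_def)
      then show ?thesis using two(2) by fastforce
    qed (use nil one in fastforce)+
  qed
  then show ?thesis
    using QV ind unfolding quasi_kernel_def independent_set_def by blast
qed

lemma acyclic_arcs_ends:
  assumes "wf_digraph D" "acyclic_digraph D"
  shows "acyclic (arcs_ends D)"
proof -
  interpret wf_digraph D by fact
  show ?thesis
    using assms(2) closed_w_imp_cycle
    by (auto simp: acyclic_def acyclic_digraph_def closed_w_def reachable1_awalk)
qed

theorem corollary1p3:
  fixes D :: "('a, 'b) pre_digraph" and n :: nat
  assumes "break_digraph D"
    and "source_free D"
    and "card (verts D) = n"
  shows "\<exists>Q. quasi_kernel D Q \<and> real (card Q) \<le> 2 * real n / 3"
proof -
  obtain S T where ST: "S \<union> T = verts D" "S \<inter> T = {}"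
    "acyclic_digraph (D \<restriction> S)" "tournament (D \<restriction> T)"
    using assms(1) unfolding break_digraph_def by blast
  interpret digraph D
    using assms(1) by (simp add: break_digraph_def oriented_graph_def)
  let ?r = "arcs_ends D"
  have fin: "finite S" "finite T"
    using ST(1) finite_verts by (auto intro: finite_subset)
  have irr: "(x, x) \<notin> ?r" for x
    using adj_not_same by blast
  have "acyclic (arcs_ends (D \<restriction> S))"
    using ST(1,3) by (intro acyclic_arcs_ends wellformed_induce_subgraph)
  moreover have "?r \<inter> S \<times> S \<subseteq> arcs_ends (D \<restriction> S)"
    by (auto simp: arcs_ends_conv)
  ultimately have acyc: "acyclic (?r \<inter> S \<times> S)"
    by (rule acyclic_subset)
  have tour: "(t, u) \<in> ?r \<or> (u, t) \<in> ?r" if "t \<in> T" "u \<in> T" "t \<noteq> u" for t u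
  proof -
    have "arcs_ends (D \<restriction> T) \<subseteq> ?r"
      by (auto simp: arcs_ends_conv)
    then show ?thesis
      using ST(4) that unfolding tournament_def induce_subgraph_verts by blast
  qed
  \<comment> \<open>Source-freeness supplies the choice \<open>f\<close> of in-neighbours.\<close>
  have "\<forall>v\<in>verts D. \<exists>u. (u, v) \<in> ?r"
    using assms(2) unfolding source_free_def source_def by blast
  then obtain f where f: "\<And>v. v \<in> verts D \<Longrightarrow> (f v, v) \<in> ?r"
    by metis
  have "\<exists>Q. rel_quasi_kernel ?r (verts D) Q \<and> 3 * card Q \<le> 2 * card (verts D)"
  proof (rule small_quasi_kernel_if_heavy[OF finite_verts])
    show "f v \<in> verts D" if "v \<in> verts D" for v
      using f[OF that] by (rule adj_in_verts(1))
  qed (use f heavy_quasi_kernel[OF fin ST(2) irr acyc tour] ST(1) in auto)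
  then obtain Q where "rel_quasi_kernel ?r (verts D) Q" "3 * card Q \<le> 2 * n"
    using assms(3) by blast
  then show ?thesis
    using quasi_kernel_if_rel_quasi_kernel[OF wf_digraph_axioms] by (intro exI[of _ Q]) auto
qed

end
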